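(* Let $p$ be a prime and let $k\geq 1$ be an integer. Let $f_k(x,y)\in\mathbb{Q}(y)[x]$ be such that for every $z\in\mathbb{C}_p$ with $|z-1|_p\geq 1$ the map $$\mu_{k,z}(a+(p^N)) = p^{N(k-1)}\, z^a\, f_k(a/p^N, z^{p^N}),\qquad N\geq 0,\ 0\leq a\leq p^N-1,$$ (all values $f_k(a/p^N,z^{p^N})$ being defined) extends to a $p$-adic distribution on $\mathbb{Z}_p$, and suppose that $f_k(x,y)$ and its partial derivatives with respect to $x$ are defined at $(0,0)$. Then for every $z\in\mathbb{C}_p$ with $|z-1|_p\geq 1$: i) $\displaystyle\int_{\mathbb{Z}_p} 1\, d\mu_{k,z} = f_k(0,z)$; ii) $\displaystyle\int_{\mathbb{Z}_p^*} 1\, d\mu_{k,z} = f_k(0,z) - p^{k-1} f_k(0,z^p)$.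
   Context: $\mathbb{C}_p$ is the completion of a fixed algebraic closure of $\mathbb{Q}_p$, with norm normalized by $|p|_p=1/p$. $(p^N)=p^N\mathbb{Z}_p$. A $p$-adic distribution on $\mathbb{Z}_p$ is a finitely additive $\mathbb{C}_p$-valued function on the compact open subsets of $\mathbb{Z}_p$; it is a measure if bounded. Under the stated hypotheses each $\mu_{k,z}$ is a measure. For a measure $\mu$ and continuous $g$, $\int_{\mathbb{Z}_p} g\,d\mu=\lim_{N\to\infty}\sum_{a=0}^{p^N-1} g(a)\mu(a+(p^N))$, and $\int_{\mathbb{Z}_p^*}g\,d\mu$ is the analogous limit with the sum restricted to $a$ with $p\nmid a$. Convention $0^0=1$. *)

theory Defs
  imports
    "HOL-Analysis.Elementary_Metric_Spaces"
    "HOL-Computational_Algebra.Computational_Algebra"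
    "HOL-Computational_Algebra.Field_as_Ring"
begin

text \<open>
  The library has no type of $p$-adic numbers, so $\mathbb{C}_p$ is specified as a structure:
  a complete valued field in which the closure of the rationals is $\mathbb{Q}_p$, and whose
  elements algebraic over $\mathbb{Q}_p$ form an algebraically closed (hence an algebraic closure
  of $\mathbb{Q}_p$) dense subfield. These conditions say that the field is the completion of an
  algebraic closure of $\mathbb{Q}_p$, and they determine it up to isometric isomorphism.
\<close>

definition Qp :: "'a::{field_char_0, metric_space} set" where
  "Qp = closure (range of_rat)"

definition Qp_alg :: "'a::{field_char_0, metric_space} set" where
  "Qp_alg = {x. \<exists>q. q \<noteq> 0 \<and> (\<forall>i. coeff q i \<in> Qp) \<and> poly q x = 0}"

locale padic_complex_field =
  fixes p :: nat and v :: "'a::{field_char_0, complete_space} \<Rightarrow> real"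
  assumes dist_v: "dist x y = v (x - y)"
    and v_mult: "v (x * y) = v x * v y"
    and v_ultrametric: "v (x + y) \<le> max (v x) (v y)"
    and v_p: "v (of_nat p) = 1 / real p"
    and alg_closed: "\<lbrakk>degree q > 0; \<And>i. coeff (q :: 'a poly) i \<in> Qp_alg\<rbrakk> \<Longrightarrow> \<exists>x\<in>Qp_alg. poly q x = 0"
    and alg_dense: "closure Qp_alg = (UNIV :: 'a set)"

definition Zp :: "('a::{field_char_0, metric_space} \<Rightarrow> real) \<Rightarrow> 'a set" where
  "Zp v = {x \<in> Qp. v x \<le> 1}"

definition disc :: "nat \<Rightarrow> ('a::{field_char_0, metric_space} \<Rightarrow> real) \<Rightarrow> nat \<Rightarrow> nat \<Rightarrow> 'a set" where
  "disc p v a N = (\<lambda>y. of_nat a + of_nat p ^ N * y) ` Zp v"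

definition compact_opens :: "('a::{field_char_0, metric_space} \<Rightarrow> real) \<Rightarrow> 'a set set" where
  "compact_opens v = {U. compact U \<and> openin (top_of_set (Zp v)) U}"

text \<open>
  Set functions are total; only their values on the compact open subsets of $\mathbb{Z}_p$ matter.
  Taking both sets empty below shows that the empty set has value 0.
\<close>

definition padic_distribution ::
    "('a::{field_char_0, metric_space} \<Rightarrow> real) \<Rightarrow> ('a set \<Rightarrow> 'a) \<Rightarrow> bool" where
  "padic_distribution v \<mu> \<longleftrightarrow>
     (\<forall>U\<in>compact_opens v. \<forall>V\<in>compact_opens v. U \<inter> V = {} \<longrightarrow> \<mu> (U \<union> V) = \<mu> U + \<mu> V)"

definition has_Zp_integral ::
    "nat \<Rightarrow> ('a::{field_char_0, metric_space} \<Rightarrow> real) \<Rightarrow> ('a set \<Rightarrow> 'a) \<Rightarrow> ('a \<Rightarrow> 'a) \<Rightarrow> 'a \<Rightarrow> bool" where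
  "has_Zp_integral p v \<mu> g I \<longleftrightarrow>
     (\<lambda>N. \<Sum>a<p ^ N. g (of_nat a) * \<mu> (disc p v a N)) \<longlonglongrightarrow> I"

definition has_Zp_units_integral ::
    "nat \<Rightarrow> ('a::{field_char_0, metric_space} \<Rightarrow> real) \<Rightarrow> ('a set \<Rightarrow> 'a) \<Rightarrow> ('a \<Rightarrow> 'a) \<Rightarrow> 'a \<Rightarrow> bool" where
  "has_Zp_units_integral p v \<mu> g I \<longleftrightarrow>
     (\<lambda>N. \<Sum>a | a < p ^ N \<and> \<not> p dvd a. g (of_nat a) * \<mu> (disc p v a N)) \<longlonglongrightarrow> I"

text \<open>
  An element of $\mathbb{Q}(y)$ is evaluated through its representation in lowest terms
  (\<^const>\<open>quot_of_fract\<close>). An element of $\mathbb{Q}(y)[x]$ has type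
  \<^typ>\<open>rat poly fract poly\<close>; its denominators involve $y$ only, so it is defined at $(x,y)$
  exactly if no coefficient has a pole at $y$, whatever $x$ is.
\<close>

definition ratfun_defined :: "rat poly fract \<Rightarrow> 'a::field_char_0 \<Rightarrow> bool" where
  "ratfun_defined r y \<longleftrightarrow> poly (map_poly of_rat (snd (quot_of_fract r))) y \<noteq> 0"

definition ratfun_eval :: "rat poly fract \<Rightarrow> 'a::field_char_0 \<Rightarrow> 'a" where
  "ratfun_eval r y =
     poly (map_poly of_rat (fst (quot_of_fract r))) y / poly (map_poly of_rat (snd (quot_of_fract r))) y"

definition defined_at :: "rat poly fract poly \<Rightarrow> 'a::field_char_0 \<Rightarrow> 'a \<Rightarrow> bool" where
  "defined_at f x y \<longleftrightarrow> (\<forall>i. ratfun_defined (coeff f i) y)"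

definition eval_at :: "rat poly fract poly \<Rightarrow> 'a::field_char_0 \<Rightarrow> 'a \<Rightarrow> 'a" where
  "eval_at f x y = poly (map_poly (\<lambda>c. ratfun_eval c y) f) x"

end

theory Submission imports Defs begin

text \<open>
  Both limits are limits of eventually constant sequences. For each \<open>N\<close> the ring of \<open>p\<close>-adic
  integers is the disjoint union of the \<open>p ^ N\<close> discs of level \<open>N\<close>, so finite additivity collapses
  the \<open>N\<close>-th Riemann sum of the constant \<open>1\<close> to the total mass (lemmas \<open>Zp_eq_UN_disc\<close> and
  \<open>sum_distribution_disc\<close>). The ring itself is the disc of level \<open>0\<close>, and there the formula for the
  distribution reads \<open>f(0, z)\<close>. In the same way, for \<open>N \<ge> 1\<close> the discs whose centre is divisible by
  \<open>p\<close> make up the maximal ideal, which is the disc of level \<open>1\<close> around \<open>0\<close>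
  (lemma \<open>maximal_ideal_eq_UN_disc\<close>); the formula gives it the mass \<open>p ^ (k - 1) f(0, z ^ p)\<close>, and
  the sum over the units is the difference of the two masses.

  Finite additivity speaks about compact open sets only, so the discs must be shown to be compact.
  This rests on the approximation of a \<open>p\<close>-adic integer by a natural number below \<open>p ^ N\<close> with error
  at most \<open>p ^ -N\<close> (lemma \<open>Zp_approx_nat\<close>), which makes the ring totally bounded.
\<close>

section \<open>The absolute value on integers and rationals\<close>

context padic_complex_field
begin

lemma v_0 [simp]: "v 0 = 0"
  using dist_v[of 0 0] by simp

lemma v_nonneg [simp]: "0 \<le> v x"
  using dist_v[of x 0] zero_le_dist[of x 0] by simp

lemma v_eq_0_iff [simp]: "v x = 0 \<longleftrightarrow> x = 0"
  using dist_v[of x 0] dist_eq_0_iff[of x 0] by simp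

lemma v_1 [simp]: "v 1 = 1"
  using v_mult[of 1 1] by simp

lemma v_minus [simp]: "v (- x) = v x"
  using dist_v[of x 0] dist_v[of 0 x] by (simp add: dist_commute)

lemma v_minus_commute: "v (x - y) = v (y - x)"
  using v_minus[of "x - y"] by simp

lemma v_diff_le_max: "v (x - z) \<le> max (v (x - y)) (v (y - z))"
  using v_ultrametric[of "x - y" "y - z"] by simp

lemma v_power: "v (x ^ n) = v x ^ n"
  by (induction n) (simp_all add: v_mult)

lemma v_divide: "y \<noteq> 0 \<Longrightarrow> v (x / y) = v x / v y"
  using v_mult[of "x / y" y] by (simp add: nonzero_eq_divide_eq)

lemma v_p_power: "v (of_nat p ^ N) = 1 / real p ^ N"
  by (simp add: v_power v_p power_one_over)

lemma v_of_nat_le_1: "v (of_nat n) \<le> 1"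
proof (induction n)
  case (Suc n)
  then show ?case using v_ultrametric[of 1 "of_nat n"] by simp
qed simp

lemma v_of_int_le_1: "v (of_int m) \<le> 1"
  by (cases m rule: int_cases2) (simp_all add: v_of_nat_le_1)

lemma v_of_int_le_if_dvd:
  assumes "int p ^ N dvd m"
  shows "v (of_int m) \<le> 1 / real p ^ N"
proof -
  obtain t where "m = int p ^ N * t" using assms by blast
  then have "v (of_int m) = 1 / real p ^ N * v (of_int t)"
    by (simp add: v_mult v_p_power)
  also have "\<dots> \<le> 1 / real p ^ N * 1"
    by (intro mult_left_mono v_of_int_le_1) simp
  finally show ?thesis by simp
qed

text \<open>
  If \<open>u * m + w * p = 1\<close>, then the ultrametric inequality bounds \<open>1\<close> by the larger of \<open>v m\<close> and
  \<open>1 / p\<close>, and the latter is less than \<open>1\<close>.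
\<close>

lemma v_of_int_eq_1:
  assumes "prime p" "\<not> int p dvd m"
  shows "v (of_int m) = 1"
proof -
  have "coprime m (int p)"
    using assms prime_imp_coprime[of "int p" m] by (simp add: coprime_commute)
  then obtain u w where uw: "u * m + w * int p = 1"
    using bezout_int[of m "int p"] by auto
  have "of_int u * of_int m + of_int w * of_nat p = (1 :: 'a)"
    using arg_cong[OF uw, of "of_int :: int \<Rightarrow> 'a"] by simp
  then have "1 \<le> max (v (of_int u) * v (of_int m)) (v (of_int w) * (1 / real p))"
    using v_ultrametric[of "of_int u * of_int m" "of_int w * of_nat p"]
    by (simp add: v_mult v_p)
  moreover have "v (of_int u) * v (of_int m) \<le> v (of_int m)"
    by (intro mult_left_le_one_le) (simp_all add: v_of_int_le_1)
  moreover have "v (of_int w) * (1 / real p) < 1"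
  proof -
    have "v (of_int w) * (1 / real p) \<le> 1 / real p"
      by (intro mult_left_le_one_le) (simp_all add: v_of_int_le_1)
    also have "\<dots> < 1" using prime_gt_1_nat[OF assms(1)] by simp
    finally show ?thesis .
  qed
  ultimately show ?thesis using v_of_int_le_1[of m] by linarith
qed

lemma v_of_int_le_iff_dvd:
  assumes "prime p"
  shows "v (of_int m) \<le> 1 / real p ^ N \<longleftrightarrow> int p ^ N dvd m"
proof
  assume le: "v (of_int m) \<le> 1 / real p ^ N"
  show "int p ^ N dvd m"
  proof (cases "m = 0")
    case False
    have p: "real p > 1" using prime_gt_1_nat[OF assms] by simp
    obtain t where t: "m = int p ^ multiplicity (int p) m * t" "\<not> int p dvd t"
      using multiplicity_decompose'[OF False, of "int p"] p by auto
    have "v (of_int m) = 1 / real p ^ multiplicity (int p) m"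
      by (subst t(1)) (simp add: v_mult v_p_power v_of_int_eq_1[OF assms t(2)])
    with le have "real p ^ N \<le> real p ^ multiplicity (int p) m"
      using p by (simp add: field_simps)
    then have "N \<le> multiplicity (int p) m"
      using p by simp
    then show ?thesis by (rule multiplicity_dvd')
  qed simp
qed (rule v_of_int_le_if_dvd)

text \<open>
  A rational of absolute value at most \<open>1\<close> has, in lowest terms, a denominator prime to \<open>p\<close>; that
  denominator has an inverse \<open>u\<close> modulo \<open>p ^ N\<close>.
\<close>

lemma of_rat_approx_nat:
  assumes "prime p" "v (of_rat q) \<le> 1"
  obtains a where "a < p ^ N" "v (of_rat q - of_nat a) \<le> 1 / real p ^ N"
proof -
  have p: "p > 1" using prime_gt_1_nat[OF assms(1)] .
  obtain m n where mn: "quotient_of q = (m, n)" by fastforce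
  have n: "n > 0" and cop: "coprime m n" and q: "q = of_int m / of_int n"
    using quotient_of_denom_pos[OF mn] quotient_of_coprime[OF mn] quotient_of_div[OF mn] by auto
  have q': "of_rat q = (of_int m / of_int n :: 'a)"
    by (simp add: q of_rat_divide)
  have "\<not> int p dvd n"
  proof
    assume "int p dvd n"
    then have "\<not> int p dvd m"
      using coprime_common_divisor[OF cop, of "int p"] p by auto
    then have "v (of_rat q) = 1 / v (of_int n)"
      using n by (simp add: q' v_divide v_of_int_eq_1[OF assms(1)])
    moreover have "v (of_int n) \<le> 1 / real p"
      using v_of_int_le_if_dvd[of 1 n] \<open>int p dvd n\<close> by simp
    moreover have "1 / real p < 1" using p by simp
    moreover have "v (of_int n) > 0"
      using n v_nonneg[of "of_int n"] by (simp add: order_less_le)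
    ultimately show False using assms(2) by (simp add: field_simps)
  qed
  then have vn: "v (of_int n) = 1" by (rule v_of_int_eq_1[OF assms(1)])
  have "coprime n (int p ^ N)"
    using \<open>\<not> int p dvd n\<close> assms(1) prime_imp_coprime[of "int p" n]
    by (simp add: coprime_commute)
  then obtain u w where uw: "u * n + w * int p ^ N = 1"
    using bezout_int[of n "int p ^ N"] by auto
  define b where "b = (m * u) mod int p ^ N"
  have b: "0 \<le> b" "b < int p ^ N" using p by (simp_all add: b_def)
  have dvd: "int p ^ N dvd m - b * n"
  proof -
    have "int p ^ N dvd m * u - b" by (simp add: b_def minus_mod_eq_mult_div)
    moreover have "m - b * n = m * (w * int p ^ N) + (m * u - b) * n"
    proof -
      have "m = m * (u * n + w * int p ^ N)" by (simp add: uw)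
      then show ?thesis by (simp add: algebra_simps)
    qed
    ultimately show ?thesis by simp
  qed
  have "of_rat q - of_int b = (of_int (m - b * n) / of_int n :: 'a)"
    using n by (simp add: q' field_simps)
  then have "v (of_rat q - of_int b) \<le> 1 / real p ^ N"
    using n vn v_of_int_le_if_dvd[OF dvd] by (simp add: v_divide del: of_int_diff)
  moreover have "of_int b = (of_nat (nat b) :: 'a)" "nat b < p ^ N"
    using b by (simp_all add: nat_less_iff)
  ultimately show ?thesis using that by metis
qed

section \<open>Discs in the ring of p-adic integers\<close>

lemma mem_Qp_iff: "x \<in> Qp \<longleftrightarrow> (\<forall>e>0. \<exists>q. v (of_rat q - x) < e)"
  by (auto simp: Qp_def closure_approachable dist_v)

lemma Qp_affine:
  fixes x :: 'a
  assumes "x \<in> Qp" "c \<noteq> 0"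
  shows "of_rat b + of_rat c * x \<in> Qp"
  unfolding mem_Qp_iff
proof (intro allI impI)
  fix e :: real assume "e > 0"
  have c: "v (of_rat c) > 0"
    using assms(2) v_nonneg[of "of_rat c"] by (simp add: order_less_le)
  then obtain q where "v (of_rat q - x) < e / v (of_rat c)"
    using assms(1) \<open>e > 0\<close> unfolding mem_Qp_iff by (meson divide_pos_pos)
  then have "v (of_rat c * (of_rat q - x)) < e"
    unfolding v_mult using c by (simp add: pos_less_divide_eq mult.commute)
  then have "v (of_rat (b + c * q) - (of_rat b + of_rat c * x)) < e"
    by (simp add: of_rat_add of_rat_mult algebra_simps)
  then show "\<exists>q. v (of_rat q - (of_rat b + of_rat c * x)) < e" ..
qed

lemma Zp_eq: "Zp v = Qp \<inter> cball 0 1"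
  by (auto simp: Zp_def dist_v)

text \<open>
  A rational closer to \<open>x\<close> than \<open>p ^ -N\<close> has absolute value at most \<open>1\<close> again, so the approximation
  \<open>of_rat_approx_nat\<close> carries over to the closure.
\<close>

lemma Zp_approx_nat:
  assumes "prime p" "x \<in> Zp v"
  obtains a where "a < p ^ N" "v (x - of_nat a) \<le> 1 / real p ^ N"
proof -
  have p: "real p > 1" using prime_gt_1_nat[OF assms(1)] by simp
  then have "0 < 1 / real p ^ N" by simp
  then obtain q where q: "v (of_rat q - x) < 1 / real p ^ N"
    using assms(2) unfolding Zp_def mem_Qp_iff by blast
  have "1 / real p ^ N \<le> 1" using p by simp
  then have "v (of_rat q) \<le> 1"
    using q assms(2) v_diff_le_max[of "of_rat q" 0 x] by (auto simp: Zp_def)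
  then obtain a where "a < p ^ N" "v (of_rat q - of_nat a) \<le> 1 / real p ^ N"
    using of_rat_approx_nat[OF assms(1)] by metis
  then show ?thesis
    using that q v_diff_le_max[of x "of_nat a" "of_rat q"] by (simp add: v_minus_commute)
qed

lemma mem_disc_iff:
  assumes "prime p"
  shows "x \<in> disc p v a N \<longleftrightarrow> x \<in> Zp v \<and> v (x - of_nat a) \<le> 1 / real p ^ N"
proof
  have p: "real p > 1" using prime_gt_1_nat[OF assms] by simp
  have a: "v (of_nat a) \<le> 1" by (rule v_of_nat_le_1)
  {
    assume "x \<in> disc p v a N"
    then obtain y where y: "y \<in> Qp" "v y \<le> 1" "x = of_nat a + of_nat p ^ N * y"
      by (auto simp: disc_def Zp_def)
    have "x \<in> Qp"
      using Qp_affine[OF y(1), of "of_nat p ^ N" "of_nat a"] p y(3) by (simp add: of_rat_power)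
    moreover have le: "v (x - of_nat a) \<le> 1 / real p ^ N"
      using y p by (simp add: v_mult v_p_power divide_right_mono)
    moreover have "v x \<le> 1"
    proof -
      have "1 / real p ^ N \<le> 1" using p by simp
      then show ?thesis using le a v_diff_le_max[of x 0 "of_nat a"] by simp
    qed
    ultimately show "x \<in> Zp v \<and> v (x - of_nat a) \<le> 1 / real p ^ N"
      by (simp add: Zp_def)
  }
  {
    assume x: "x \<in> Zp v \<and> v (x - of_nat a) \<le> 1 / real p ^ N"
    define y where "y = (x - of_nat a) / of_nat p ^ N"
    have p0: "(of_nat p :: 'a) \<noteq> 0" using p by simp
    have "y = of_rat (- of_nat a / of_nat p ^ N) + of_rat (1 / of_nat p ^ N) * x"
      using p0 by (simp add: y_def of_rat_divide of_rat_power of_rat_minus field_simps)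
    then have "y \<in> Qp" using Qp_affine[of x "1 / of_nat p ^ N" "- of_nat a / of_nat p ^ N"] x p
      by (simp add: Zp_def)
    moreover have "v y \<le> 1"
      using x p p0 by (simp add: y_def v_divide v_p_power field_simps)
    moreover have "x = of_nat a + of_nat p ^ N * y" using p0 by (simp add: y_def)
    ultimately show "x \<in> disc p v a N" by (auto simp: disc_def Zp_def)
  }
qed

lemma compact_Zp:
  assumes "prime p"
  shows "compact (Zp v)"
  unfolding compact_eq_totally_bounded
proof (intro conjI allI impI)
  show "complete (Zp v)"
    unfolding complete_eq_closed Zp_eq Qp_def by (intro closed_Int closed_closure closed_cball)
next
  fix e :: real assume "e > 0"
  have p: "real p > 1" using prime_gt_1_nat[OF assms] by simp
  then obtain N where "(1 / real p) ^ N < e"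
    using real_arch_pow_inv[OF \<open>e > 0\<close>, of "1 / real p"] by auto
  then have N: "1 / real p ^ N < e" by (simp add: power_one_over)
  have "Zp v \<subseteq> (\<Union>x\<in>of_nat ` {..<p ^ N}. ball x e)"
  proof
    fix x assume "x \<in> Zp v"
    then obtain a where "a < p ^ N" "v (x - of_nat a) \<le> 1 / real p ^ N"
      using Zp_approx_nat[OF assms] by metis
    then show "x \<in> (\<Union>x\<in>of_nat ` {..<p ^ N}. ball x e)"
      using N by (force simp: dist_v v_minus_commute)
  qed
  then show "\<exists>k. finite k \<and> Zp v \<subseteq> (\<Union>x\<in>k. ball x e)"
    by (intro exI[of _ "of_nat ` {..<p ^ N}"]) simp
qed

lemma disc_in_compact_opens:
  assumes "prime p"
  shows "disc p v a N \<in> compact_opens v"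
proof -
  have p: "real p > 1" using prime_gt_1_nat[OF assms] by simp
  have "disc p v a N = Zp v \<inter> cball (of_nat a) (1 / real p ^ N)"
    by (auto simp: mem_disc_iff[OF assms] dist_v v_minus_commute)
  then have "compact (disc p v a N)"
    by (simp add: compact_Zp[OF assms] compact_Int_closed)
  moreover have "openin (top_of_set (Zp v)) (disc p v a N)"
    unfolding openin_euclidean_subtopology_iff
  proof (intro conjI ballI)
    show "disc p v a N \<subseteq> Zp v" by (auto simp: mem_disc_iff[OF assms])
  next
    \<comment> \<open>By the ultrametric inequality a disc contains the ball of its own radius around each of
      its points.\<close>
    fix x assume x: "x \<in> disc p v a N"
    have "y \<in> disc p v a N" if "y \<in> Zp v" "dist y x < 1 / real p ^ N" for y
      using that x v_diff_le_max[of y "of_nat a" x] by (auto simp: mem_disc_iff[OF assms] dist_v)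
    then show "\<exists>e>0. \<forall>y\<in>Zp v. dist y x < e \<longrightarrow> y \<in> disc p v a N"
      using p by (intro exI[of _ "1 / real p ^ N"]) auto
  qed
  ultimately show ?thesis by (simp add: compact_opens_def)
qed

lemma disjnt_discs:
  assumes "prime p" "a < p ^ N" "b < p ^ N" "a \<noteq> b"
  shows "disc p v a N \<inter> disc p v b N = {}"
proof (rule ccontr)
  assume "\<not> ?thesis"
  then obtain x where "v (x - of_nat a) \<le> 1 / real p ^ N" "v (x - of_nat b) \<le> 1 / real p ^ N"
    by (auto simp: mem_disc_iff[OF assms(1)])
  then have "v (of_int (int a - int b)) \<le> 1 / real p ^ N"
    using v_diff_le_max[of "of_nat a" "of_nat b" x] by (simp add: v_minus_commute)
  then have "int p ^ N dvd int a - int b"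
    using v_of_int_le_iff_dvd[OF assms(1)] by blast
  then have "int a mod int (p ^ N) = int b mod int (p ^ N)"
    by (simp add: mod_eq_dvd_iff)
  then show False
    using assms by (simp flip: of_nat_mod)
qed

lemma Zp_eq_UN_disc:
  assumes "prime p"
  shows "Zp v = (\<Union>a<p ^ N. disc p v a N)"
proof (intro equalityI subsetI)
  fix x assume x: "x \<in> Zp v"
  then obtain a where "a < p ^ N" "v (x - of_nat a) \<le> 1 / real p ^ N"
    using Zp_approx_nat[OF assms] by metis
  then show "x \<in> (\<Union>a<p ^ N. disc p v a N)"
    using x by (auto simp: mem_disc_iff[OF assms])
qed (auto simp: mem_disc_iff[OF assms])

lemma Zp_eq_disc: "Zp v = disc p v 0 0"
  by (simp add: disc_def)

text \<open>
  For \<open>N \<ge> 1\<close> a point of a disc of level \<open>N\<close> differs from the centre \<open>a\<close> by at most \<open>1 / p\<close>. Hence it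
  lies in the maximal ideal exactly if \<open>a\<close> does, that is, if \<open>p\<close> divides \<open>a\<close>.
\<close>

lemma maximal_ideal_eq_UN_disc:
  assumes "prime p" "N \<ge> 1"
  shows "disc p v 0 1 = (\<Union>a\<in>{a. a < p ^ N \<and> p dvd a}. disc p v a N)"
proof -
  have p: "real p > 1" using prime_gt_1_nat[OF assms(1)] by simp
  have le: "1 / real p ^ N \<le> 1 / real p"
    using p assms(2) power_increasing[of 1 N "real p"] by (simp add: field_simps)
  have iff: "v x \<le> 1 / real p \<longleftrightarrow> p dvd a" if "v (x - of_nat a) \<le> 1 / real p ^ N" for x a
  proof -
    have "v x \<le> 1 / real p \<longleftrightarrow> v (of_nat a) \<le> 1 / real p"
      using that le v_diff_le_max[of x 0 "of_nat a"] v_diff_le_max[of "of_nat a" 0 x]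
      by (auto simp: v_minus_commute)
    also have "\<dots> \<longleftrightarrow> p dvd a"
      using v_of_int_le_iff_dvd[OF assms(1), of "int a" 1] by simp
    finally show ?thesis .
  qed
  show ?thesis
  proof (intro equalityI subsetI)
    fix x assume x: "x \<in> disc p v 0 1"
    then have "x \<in> Zp v" by (simp add: mem_disc_iff[OF assms(1)])
    then obtain a where "a < p ^ N" "x \<in> disc p v a N"
      using Zp_eq_UN_disc[OF assms(1), of N] by auto
    then show "x \<in> (\<Union>a\<in>{a. a < p ^ N \<and> p dvd a}. disc p v a N)"
      using x iff[of x a] by (auto simp: mem_disc_iff[OF assms(1)])
  qed (auto simp: mem_disc_iff[OF assms(1)] iff)
qed

section \<open>Finite additivity over discs\<close>

lemma sum_distribution_disc:
  assumes "prime p" "padic_distribution v m" "A \<subseteq> {..<p ^ N}"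
  shows "(\<Sum>a\<in>A. m (disc p v a N)) = m (\<Union>a\<in>A. disc p v a N)"
proof -
  note add = assms(2)[unfolded padic_distribution_def, rule_format]
  have UN: "(\<Union>a\<in>B. disc p v a N) \<in> compact_opens v" if "finite B" for B
    using that disc_in_compact_opens[OF assms(1), of _ N]
    by (auto simp: compact_opens_def intro!: compact_UN)
  have "finite A" using assms(3) finite_subset by blast
  then show ?thesis using assms(3)
  proof (induction A)
    case empty
    have "{} \<in> compact_opens v" by (simp add: compact_opens_def)
    then show ?case using add[of "{}" "{}"] by simp
  next
    case (insert a B)
    have "disc p v a N \<inter> (\<Union>b\<in>B. disc p v b N) = {}"
      using disjnt_discs[OF assms(1)] insert by blast
    then show ?case
      using add[OF disc_in_compact_opens[OF assms(1)] UN[OF insert(1)]] insert by simp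
  qed
qed

end

section \<open>The two integrals\<close>

theorem proposition1:
  fixes p k :: nat
    and v :: "'a::{field_char_0, complete_space} \<Rightarrow> real"
    and f :: "rat poly fract poly"
    and \<mu> :: "'a \<Rightarrow> 'a set \<Rightarrow> 'a"
  assumes "prime p" and "k \<ge> 1"
    and "padic_complex_field p v"
    and "\<And>z N a. \<lbrakk>v (z - 1) \<ge> 1; a < p ^ N\<rbrakk> \<Longrightarrow>
           defined_at f (of_nat a / of_nat p ^ N) (z ^ (p ^ N))"
    and "\<And>z. v (z - 1) \<ge> 1 \<Longrightarrow> padic_distribution v (\<mu> z)"
    and "\<And>z N a. \<lbrakk>v (z - 1) \<ge> 1; a < p ^ N\<rbrakk> \<Longrightarrow>
           \<mu> z (disc p v a N) =
             of_nat p ^ (N * (k - 1)) * z ^ a * eval_at f (of_nat a / of_nat p ^ N) (z ^ (p ^ N))"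
    and "\<And>j. defined_at ((pderiv ^^ j) f) (0::'a) 0"
  shows "\<And>z. v (z - 1) \<ge> 1 \<Longrightarrow>
           has_Zp_integral p v (\<mu> z) (\<lambda>_. 1) (eval_at f 0 z) \<and>
           has_Zp_units_integral p v (\<mu> z) (\<lambda>_. 1)
             (eval_at f 0 z - of_nat p ^ (k - 1) * eval_at f 0 (z ^ p))"
proof -
  fix z :: 'a assume z: "v (z - 1) \<ge> 1"
  interpret padic_complex_field p v by fact
  have p: "p > 1" using prime_gt_1_nat[OF assms(1)] .
  note sum_disc = sum_distribution_disc[OF assms(1) assms(5)[OF z]]
  have mass: "\<mu> z (Zp v) = eval_at f 0 z"
    unfolding Zp_eq_disc using assms(6)[OF z, of 0 0] by simp
  have ideal: "\<mu> z (disc p v 0 1) = of_nat p ^ (k - 1) * eval_at f 0 (z ^ p)"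
    using assms(6)[OF z, of 0 1] p by simp
  have total: "(\<Sum>a<p ^ N. \<mu> z (disc p v a N)) = eval_at f 0 z" for N
    using sum_disc[of "{..<p ^ N}" N] Zp_eq_UN_disc[OF assms(1), of N] mass by simp
  have units: "(\<Sum>a | a < p ^ N \<and> \<not> p dvd a. \<mu> z (disc p v a N)) =
      eval_at f 0 z - of_nat p ^ (k - 1) * eval_at f 0 (z ^ p)" if "N \<ge> 1" for N
  proof -
    have "(\<Sum>a<p ^ N. \<mu> z (disc p v a N)) =
        (\<Sum>a | a < p ^ N \<and> \<not> p dvd a. \<mu> z (disc p v a N)) +
        (\<Sum>a | a < p ^ N \<and> p dvd a. \<mu> z (disc p v a N))"
      by (subst sum.union_disjoint[symmetric]) (auto intro!: sum.cong)
    moreover have "(\<Sum>a | a < p ^ N \<and> p dvd a. \<mu> z (disc p v a N)) = \<mu> z (disc p v 0 1)"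
      using sum_disc[of "{a. a < p ^ N \<and> p dvd a}" N] maximal_ideal_eq_UN_disc[OF assms(1) that]
      by auto
    ultimately show ?thesis using total ideal by (simp add: algebra_simps)
  qed
  show "has_Zp_integral p v (\<mu> z) (\<lambda>_. 1) (eval_at f 0 z) \<and>
        has_Zp_units_integral p v (\<mu> z) (\<lambda>_. 1)
          (eval_at f 0 z - of_nat p ^ (k - 1) * eval_at f 0 (z ^ p))"
  proof
    show "has_Zp_integral p v (\<mu> z) (\<lambda>_. 1) (eval_at f 0 z)"
      by (simp add: has_Zp_integral_def total)
    \<comment> \<open>At level \<open>0\<close> the only centre is \<open>0\<close>, so the sum over the units is empty there and has its
      limiting value from level \<open>1\<close> on.\<close>
    show "has_Zp_units_integral p v (\<mu> z) (\<lambda>_. 1)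
        (eval_at f 0 z - of_nat p ^ (k - 1) * eval_at f 0 (z ^ p))"
      unfolding has_Zp_units_integral_def
      by (rule tendsto_eventually, rule eventually_sequentiallyI[of 1]) (simp add: units)
  qed
qed

end
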